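(* Let $A,B,C$ be three logically independent events and let $(x,y,t)\in[0,1]^3$ be any assessment on the sequence of conditional events $(B|C,\ \overline{B}|A,\ A|(A\vee C))$. Then the extension $z=p(\overline{C}|A)$ of $(x,y,t)$ is coherent (i.e. the assessment $(x,y,t,z)$ on $(B|C,\overline{B}|A,A|(A\vee C),\overline{C}|A)$ is coherent) if and only if $z\in[z',z'']$, where \[ [z',z'']=\begin{cases} [0,1], & \text{if } t\le x+yt\le 1,\\[2pt] \left[\dfrac{x+yt-1}{t\,x},\,1\right], & \text{if } x+yt>1,\\[8pt] \left[\dfrac{t-x-yt}{t\,(1-x)},\,1\right], & \text{if } x+yt<t. \end{cases} \]
   Context: Events are elements of a Boolean algebra (e.g. subsets of a set $\Omega$), identified with their $\{0,1\}$-valued indicators; $\overline{E}$ is the negation of $E$ and juxtaposition or $\wedge$ is conjunction. Events $A,B,C$ are logically independent if all $8$ conjunctions obtained by choosing each of them or its negation are different from the impossible event $\bot$. For events $E,H$ with $H\ne\bot$, the conditional event $E|H$ is true if $EH$ is true, false if $\overline{E}H$ is true, and void if $H$ is false. Coherence: an assessment $\mathcal P=(p_1,\dots,p_n)\in\mathbb R^n$ on $\mathcal F=(E_1|H_1,\dots,E_n|H_n)$ is coherent if for every nonempty $J\subseteq\{1,\dots,n\}$ and all real numbers $s_j$ ($j\in J$), the random gain $G=\sum_{j\in J}s_jH_j(E_j-p_j)$, restricted to $\bigvee_{j\in J}H_j$ (i.e. considering only its values when at least one $H_j$, $j\in J$, is true), has minimum $\le 0$ and maximum $\ge 0$. No positivity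 of the probability of conditioning events is assumed. *)

theory Defs
  imports Complex_Main
begin

text \<open>
  Events are elements of an arbitrary Boolean algebra, with \<open>\<bottom>\<close> the impossible event.
  A pair \<open>(E, H)\<close> stands for the conditional event \<open>E|H\<close>.
\<close>

type_synonym 'a cond_event = "'a \<times> 'a"

definition literal :: "'a::boolean_algebra \<Rightarrow> bool \<Rightarrow> 'a" where
  "literal X b = (if b then X else - X)"

definition logically_independent3 :: "'a::boolean_algebra \<Rightarrow> 'a \<Rightarrow> 'a \<Rightarrow> bool" where
  "logically_independent3 A B C \<longleftrightarrow>
     (\<forall>a b c. inf (inf (literal A a) (literal B b)) (literal C c) \<noteq> bot)"

text \<open>
  An abstract Boolean algebra has no sample points. The joint values that the indicators of
  the events in \<open>Xs\<close> can take are those truth assignments \<open>v\<close> for which the corresponding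
  conjunction of events and negated events is not impossible. For an algebra of sets these
  are exactly the assignments realised at some point; see \<open>possible_set_iff\<close> below.
\<close>

definition possible :: "('a::boolean_algebra) list \<Rightarrow> ('a \<Rightarrow> bool) \<Rightarrow> bool" where
  "possible Xs v \<longleftrightarrow> foldr inf (map (\<lambda>X. literal X (v X)) Xs) top \<noteq> bot"

definition gain ::
  "('a cond_event) list \<Rightarrow> real list \<Rightarrow> nat set \<Rightarrow> (nat \<Rightarrow> real) \<Rightarrow> ('a \<Rightarrow> bool) \<Rightarrow> real" where
  "gain F P J s v =
     (\<Sum>j\<in>J. s j * of_bool (v (snd (F ! j))) * (of_bool (v (fst (F ! j))) - P ! j))"

text \<open>The values of the gain restricted to the disjunction of the conditioning events in \<open>J\<close>.\<close>

definition gain_values ::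
  "('a::boolean_algebra cond_event) list \<Rightarrow> real list \<Rightarrow> nat set \<Rightarrow> (nat \<Rightarrow> real) \<Rightarrow> real set" where
  "gain_values F P J s =
     {gain F P J s v | v. possible (map fst F @ map snd F) v \<and> (\<exists>j\<in>J. v (snd (F ! j)))}"

definition coherent :: "('a::boolean_algebra cond_event) list \<Rightarrow> real list \<Rightarrow> bool" where
  "coherent F P \<longleftrightarrow>
     length P = length F \<and> (\<forall>(E, H) \<in> set F. H \<noteq> bot) \<and>
     (\<forall>J s. J \<noteq> {} \<and> J \<subseteq> {..<length F} \<longrightarrow>
        Min (gain_values F P J s) \<le> 0 \<and> Max (gain_values F P J s) \<ge> 0)"

text \<open>
  The minimum and maximum above are taken over a finite set, which is nonempty when the
  conditioning events are not impossible.
\<close>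

lemma gain_values_finite:
  assumes "J \<subseteq> {..<length F}"
  shows "finite (gain_values F P J s)"
proof -
  define S where "S = set (map fst F @ map snd F)"
  have "gain_values F P J s \<subseteq> (\<lambda>T. gain F P J s (\<lambda>X. X \<in> T)) ` Pow S"
  proof
    fix g assume "g \<in> gain_values F P J s"
    then obtain v where g: "g = gain F P J s v"
      by (auto simp: gain_values_def)
    have "gain F P J s v = gain F P J s (\<lambda>X. X \<in> {X\<in>S. v X})"
      unfolding gain_def using assms by (intro sum.cong) (auto simp: S_def)
    with g show "g \<in> (\<lambda>T. gain F P J s (\<lambda>X. X \<in> T)) ` Pow S"
      by blast
  qed
  moreover have "finite S" by (simp add: S_def)
  ultimately show ?thesis
    by (meson finite_Pow_iff finite_imageI finite_subset)
qed

lemma foldr_literal_le: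
  "X \<in> set Xs \<Longrightarrow> foldr inf (map (\<lambda>X. literal X (v X)) Xs) top \<le> literal X (v X)"
  by (induction Xs) (auto intro: le_infI2)

lemma foldr_literal_extend:
  fixes K :: "'a::boolean_algebra"
  assumes "K \<noteq> bot"
  shows "\<exists>v. inf K (foldr inf (map (\<lambda>X. literal X (v X)) Xs) top) \<noteq> bot"
  using assms
proof (induction Xs arbitrary: K)
  case Nil
  then show ?case by simp
next
  case (Cons X Xs)
  then obtain v where v: "inf K (foldr inf (map (\<lambda>X. literal X (v X)) Xs) top) \<noteq> bot" (is "?R \<noteq> bot")
    by blast
  show ?case
  proof (cases "X \<in> set Xs")
    case True
    have "foldr inf (map (\<lambda>X. literal X (v X)) Xs) top \<le> literal X (v X)"
      using True by (rule foldr_literal_le)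
    then have "inf (literal X (v X)) (foldr inf (map (\<lambda>X. literal X (v X)) Xs) top)
        = foldr inf (map (\<lambda>X. literal X (v X)) Xs) top"
      by (rule inf_absorb2)
    with v have "inf K (foldr inf (map (\<lambda>Y. literal Y (v Y)) (X # Xs)) top) \<noteq> bot" by simp
    then show ?thesis by blast
  next
    case False
    have "?R = sup (inf X ?R) (inf (- X) ?R)"
      by (simp flip: inf_sup_distrib2)
    with v have "inf X ?R \<noteq> bot \<or> inf (- X) ?R \<noteq> bot" by auto
    then have "inf (literal X True) ?R \<noteq> bot \<or> inf (literal X False) ?R \<noteq> bot"
      by (simp add: literal_def)
    then obtain b where b: "inf (literal X b) ?R \<noteq> bot" by blast
    have "map (\<lambda>Y. literal Y ((v(X := b)) Y)) Xs = map (\<lambda>Y. literal Y (v Y)) Xs"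
      using False by auto
    then have "foldr inf (map (\<lambda>Y. literal Y ((v(X := b)) Y)) (X # Xs)) top
        = inf (literal X b) (foldr inf (map (\<lambda>Y. literal Y (v Y)) Xs) top)"
      by (simp only: list.map foldr.simps o_apply fun_upd_same)
    with b have "inf K (foldr inf (map (\<lambda>Y. literal Y ((v(X := b)) Y)) (X # Xs)) top) \<noteq> bot"
      by (simp only: inf_left_commute not_False_eq_True)
    then show ?thesis by (rule exI[of _ "v(X := b)"])
  qed
qed

lemma gain_values_nonempty:
  assumes "J \<noteq> {}" "J \<subseteq> {..<length F}" "\<forall>(E, H) \<in> set F. H \<noteq> bot"
  shows "gain_values F P J s \<noteq> {}"
proof -
  obtain j where j: "j \<in> J" "j < length F" using assms by blast
  define Xs where "Xs = map fst F @ map snd F"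
  let ?H = "snd (F ! j)"
  have "?H \<noteq> bot" using assms(3) j(2) nth_mem by fastforce
  then obtain v where v: "inf ?H (foldr inf (map (\<lambda>X. literal X (v X)) Xs) top) \<noteq> bot"
    using foldr_literal_extend by blast
  have mem: "?H \<in> set Xs" using j by (simp add: Xs_def)
  have "foldr inf (map (\<lambda>X. literal X (v X)) Xs) top \<le> literal ?H (v ?H)"
    using mem by (rule foldr_literal_le)
  then have "inf ?H (foldr inf (map (\<lambda>X. literal X (v X)) Xs) top) \<le> inf ?H (literal ?H (v ?H))"
    by (rule inf_mono[OF order_refl])
  with v have "inf ?H (literal ?H (v ?H)) \<noteq> bot"
    by (metis bot_unique)
  then have "v ?H" by (cases "v ?H") (simp_all add: literal_def)
  moreover have "possible Xs v" using v by (auto simp: possible_def)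
  ultimately show ?thesis using j by (auto simp: gain_values_def Xs_def)
qed

text \<open>For events that are sets, the gain ranges over the points of the union of the \<open>H\<^sub>j\<close>.\<close>

lemma possible_set_iff:
  fixes Xs :: "'w set list"
  shows "possible Xs v \<longleftrightarrow> (\<exists>\<omega>. \<forall>X\<in>set Xs. v X \<longleftrightarrow> \<omega> \<in> X)"
proof -
  have "\<omega> \<in> foldr inf (map (\<lambda>X. literal X (v X)) Xs) top \<longleftrightarrow> (\<forall>X\<in>set Xs. v X \<longleftrightarrow> \<omega> \<in> X)" for \<omega>
    by (induction Xs) (auto simp: literal_def)
  then show ?thesis unfolding possible_def by blast
qed

lemma gain_values_set:
  fixes F :: "('w set cond_event) list"
  assumes "J \<subseteq> {..<length F}"
  shows "gain_values F P J s =
    (\<lambda>\<omega>. \<Sum>j\<in>J. s j * of_bool (\<omega> \<in> snd (F ! j)) * (of_bool (\<omega> \<in> fst (F ! j)) - P ! j))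
      ` (\<Union>j\<in>J. snd (F ! j))" (is "_ = ?g ` _")
proof (intro equalityI subsetI)
  fix r assume "r \<in> gain_values F P J s"
  then obtain v where r: "r = gain F P J s v" "\<exists>j\<in>J. v (snd (F ! j))"
    and v: "possible (map fst F @ map snd F) v"
    unfolding gain_values_def by blast
  from v obtain \<omega> where w: "\<forall>X \<in> set (map fst F @ map snd F). v X \<longleftrightarrow> \<omega> \<in> X"
    unfolding possible_set_iff by blast
  have vw: "v (fst (F ! j)) \<longleftrightarrow> \<omega> \<in> fst (F ! j)" "v (snd (F ! j)) \<longleftrightarrow> \<omega> \<in> snd (F ! j)"
    if "j \<in> J" for j
  proof -
    have "F ! j \<in> set F" using that assms by auto
    then have "fst (F ! j) \<in> set (map fst F @ map snd F)" "snd (F ! j) \<in> set (map fst F @ map snd F)"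
      by simp_all
    with w show "v (fst (F ! j)) \<longleftrightarrow> \<omega> \<in> fst (F ! j)" "v (snd (F ! j)) \<longleftrightarrow> \<omega> \<in> snd (F ! j)"
      by blast+
  qed
  have "r = ?g \<omega>" unfolding r(1) gain_def by (intro sum.cong refl) (simp only: vw)
  moreover have "\<omega> \<in> (\<Union>j\<in>J. snd (F ! j))" using r(2) vw(2) by blast
  ultimately show "r \<in> ?g ` (\<Union>j\<in>J. snd (F ! j))" by (rule image_eqI)
next
  fix r assume "r \<in> ?g ` (\<Union>j\<in>J. snd (F ! j))"
  then obtain \<omega> where w: "r = ?g \<omega>" "\<exists>j\<in>J. \<omega> \<in> snd (F ! j)" by blast
  have "r = gain F P J s (\<lambda>X. \<omega> \<in> X)" using w(1) by (simp only: gain_def)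
  moreover have "possible (map fst F @ map snd F) (\<lambda>X. \<omega> \<in> X)"
    unfolding possible_set_iff by blast
  ultimately show "r \<in> gain_values F P J s"
    unfolding gain_values_def using w(2) by blast
qed

end

theory Submission
  imports Defs
begin

text \<open>
  Both directions rest on the duality between betting and averaging: a gain cannot be of
  one strict sign if some probability distribution on the outcomes that are in play gives
  it expectation \<open>0\<close>.

  By logical independence, the outcomes are all the truth values \<open>(a, b, c)\<close> of
  \<open>(A, B, C)\<close> (\<open>coherent_iff_gain_signs\<close>). Suppose that a distribution on \<open>A \<or> C\<close> is
  compatible with \<open>(x, y, t, z)\<close>. Then \<open>P(A) = t\<close>, \<open>P(A \<not>B) = ty\<close>, \<open>P(A \<not>C) = tz\<close>, so
  \<open>P(C) = 1 - tz\<close> and \<open>P(BC) = x(1 - tz)\<close>. The Frechet bounds for \<open>P(ABC)\<close>, whose margins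
  in \<open>A\<close> are now fixed, and \<open>0 \<le> P(\<not>A BC) \<le> 1 - t\<close> confine \<open>P(BC)\<close> to the interval from
  \<open>max 0 (t(1 - y - z))\<close> to \<open>1 - t + t min (1 - y) (1 - z)\<close>. The bounds that do not hold
  for all \<open>z\<close> in \<open>[0, 1]\<close> are the two linear inequalities
  \<open>t(1 - y - z) \<le> x(1 - tz)\<close> and \<open>x(1 - tz) \<le> 1 - ty\<close>, and these, solved for \<open>z\<close>, are the lower bounds of the theorem. At most one of them is
  positive, because the first needs \<open>x + yt < t \<le> 1\<close> and the second \<open>x + yt > 1\<close>.

  If one of the inequalities fails, the pointwise inequality between indicators behind it,
  \<open>A \<le> BC + A \<not>B + A \<not>C\<close> or \<open>BC + A \<not>B \<le> 1\<close>, supplies stakes with a gain of one strict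
  sign (\<open>coherent_imp_inequalities\<close>). Conversely, if both hold, the required distribution
  exists (\<open>joint_masses\<close>), but it serves only bets that involve \<open>A|(A \<or> C)\<close>: for other
  bets the disjunction of the conditioning events may be smaller than \<open>A \<or> C\<close> and may have
  probability \<open>0\<close>. Bets on \<open>\<not>B|A\<close> and \<open>\<not>C|A\<close> alone use a distribution on \<open>A\<close>, and bets
  that include \<open>B|C\<close> but not \<open>A|(A \<or> C)\<close> one on \<open>\<not>A C\<close>, where the bets given \<open>A\<close> are
  called off.
\<close>

section \<open>Outcomes of a Boolean algebra\<close>

text \<open>
  A nonzero element that decides every event in the list behaves like a sample point.
\<close>

lemma possible_of_deciding_element:
  fixes K :: "'a::boolean_algebra"
  assumes "K \<noteq> bot" and "\<And>X. X \<in> set Xs \<Longrightarrow> K \<le> X \<or> K \<le> - X"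
  shows "possible Xs (\<lambda>X. K \<le> X)"
proof -
  have "K \<le> foldr inf (map (\<lambda>X. literal X (K \<le> X)) Xs) top"
    using assms(2) by (induction Xs) (auto simp: literal_def)
  with assms(1) show ?thesis
    unfolding possible_def by (metis bot_unique)
qed

lemma possible_imp_literals_compatible:
  fixes Xs :: "'a::boolean_algebra list"
  assumes "possible Xs v" "X \<in> set Xs" "Y \<in> set Xs" "Z \<in> set Xs"
  shows "inf (literal X (v X)) (inf (literal Y (v Y)) (literal Z (v Z))) \<noteq> bot"
proof -
  let ?K = "foldr inf (map (\<lambda>X. literal X (v X)) Xs) top"
  have "?K \<le> inf (literal X (v X)) (inf (literal Y (v Y)) (literal Z (v Z)))"
    using assms(2-4) by (simp add: foldr_literal_le del: foldr_map)
  moreover have "?K \<noteq> bot" using assms(1) by (simp only: possible_def not_False_eq_True)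
  ultimately show ?thesis by (metis bot_unique)
qed

section \<open>Coherence on the eight constituents\<close>

text \<open>
  Truth values, at an outcome \<open>(a, b, c)\<close>, of the conditioning event and of the
  conditioned event of the \<open>j\<close>-th member of \<open>(B|C, \<not>B|A, A|(A \<or> C), \<not>C|A)\<close>.
\<close>

definition given_holds :: "bool \<times> bool \<times> bool \<Rightarrow> nat \<Rightarrow> bool" where
  "given_holds = (\<lambda>(a, b, c) j. [c, a, a \<or> c, a] ! j)"

definition event_holds :: "bool \<times> bool \<times> bool \<Rightarrow> nat \<Rightarrow> bool" where
  "event_holds = (\<lambda>(a, b, c) j. [b, \<not> b, a, \<not> c] ! j)"

definition unit_gain :: "real list \<Rightarrow> nat \<Rightarrow> bool \<times> bool \<times> bool \<Rightarrow> real" where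
  "unit_gain P j \<omega> = of_bool (given_holds \<omega> j) * (of_bool (event_holds \<omega> j) - P ! j)"

text \<open>
  By logical independence, each of the eight conjunctions of \<open>A\<close>, \<open>B\<close>, \<open>C\<close> or their
  negations is an element that decides all the events of the family, so the values of a gain
  are the same in every Boolean algebra.
\<close>

lemma gain_values_constituents:
  fixes A B C :: "'a::boolean_algebra"
  defines "F \<equiv> [(B, C), (- B, A), (A, sup A C), (- C, A)]"
  assumes indep: "logically_independent3 A B C" and J: "J \<subseteq> {..<4}"
  shows "gain_values F P J s =
    {\<Sum>j\<in>J. s j * unit_gain P j \<omega> | \<omega>. \<exists>j\<in>J. given_holds \<omega> j}"
proof -
  have gain_eq: "gain F P J s v = (\<Sum>j\<in>J. s j * unit_gain P j \<omega>)"
    and given_eq: "(\<exists>j\<in>J. v (snd (F ! j))) \<longleftrightarrow> (\<exists>j\<in>J. given_holds \<omega> j)"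
    if v: "\<omega> = (v A, v B, v C)" "v (- B) \<longleftrightarrow> \<not> v B" "v (- C) \<longleftrightarrow> \<not> v C"
      "v (sup A C) \<longleftrightarrow> v A \<or> v C" for v \<omega>
  proof -
    have four: "j = 0 \<or> j = 1 \<or> j = 2 \<or> j = 3" if "j \<in> J" for j
      using that J by auto
    have "v (fst (F ! j)) = event_holds \<omega> j \<and> v (snd (F ! j)) = given_holds \<omega> j" if "j \<in> J" for j
      using four[OF that] v
      by (elim disjE) (simp_all add: F_def event_holds_def given_holds_def)
    then show "gain F P J s v = (\<Sum>j\<in>J. s j * unit_gain P j \<omega>)"
      and "(\<exists>j\<in>J. v (snd (F ! j))) \<longleftrightarrow> (\<exists>j\<in>J. given_holds \<omega> j)"
      by (simp_all add: gain_def unit_gain_def mult.assoc cong: sum.cong)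
  qed
  let ?Xs = "map fst F @ map snd F"
  have events: "set ?Xs = {A, B, C, - B, - C, sup A C}"
    by (auto simp: F_def)
  have truth_values: "(v (- B) \<longleftrightarrow> \<not> v B) \<and> (v (- C) \<longleftrightarrow> \<not> v C) \<and> (v (sup A C) \<longleftrightarrow> v A \<or> v C)"
    if "possible ?Xs v" for v
  proof -
    note compatible = possible_imp_literals_compatible[OF that, unfolded events literal_def]
    have "v (- B) \<longleftrightarrow> \<not> v B" using compatible[of B "- B" B] by (auto split: if_splits)
    moreover have "v (- C) \<longleftrightarrow> \<not> v C" using compatible[of C "- C" C] by (auto split: if_splits)
    moreover have "v (sup A C) \<longleftrightarrow> v A \<or> v C"
      using compatible[of A C "sup A C"]
      by (auto split: if_splits simp: inf_sup_distrib1 inf_commute inf_left_commute)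
    ultimately show ?thesis by blast
  qed
  have realised: "\<exists>v. possible ?Xs v \<and> \<omega> = (v A, v B, v C)" for \<omega>
  proof -
    obtain a b c where \<omega>: "\<omega> = (a, b, c)" by (cases \<omega>)
    define K where "K = inf (inf (literal A a) (literal B b)) (literal C c)"
    have "K \<noteq> bot" using indep by (simp add: logically_independent3_def K_def)
    have below: "K \<le> literal A a" "K \<le> literal B b" "K \<le> literal C c"
      by (auto simp: K_def intro: le_infI1 le_infI2)
    have excl: "\<not> K \<le> X" if "K \<le> - X" for X
      using that \<open>K \<noteq> bot\<close> le_infI[of K X "- X"] by (auto simp: bot_unique)
    have dec: "(K \<le> A) = a" "(K \<le> B) = b" "(K \<le> C) = c"
      using below excl by (auto simp: literal_def split: if_splits)
    have neg: "\<not> a \<Longrightarrow> K \<le> - A" "\<not> b \<Longrightarrow> K \<le> - B" "\<not> c \<Longrightarrow> K \<le> - C"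
      using below by (auto simp: literal_def)
    have "K \<le> X \<or> K \<le> - X" if "X \<in> set ?Xs" for X
      using that dec neg unfolding events by (auto intro: le_supI1 le_supI2)
    with \<open>K \<noteq> bot\<close> have "possible ?Xs (\<lambda>X. K \<le> X)"
      by (rule possible_of_deciding_element)
    then show ?thesis using dec \<omega> by auto
  qed
  show ?thesis
  proof (intro equalityI subsetI)
    fix r assume "r \<in> gain_values F P J s"
    then obtain v where v: "r = gain F P J s v" "possible ?Xs v" "\<exists>j\<in>J. v (snd (F ! j))"
      unfolding gain_values_def by blast
    have tv: "v (- B) \<longleftrightarrow> \<not> v B" "v (- C) \<longleftrightarrow> \<not> v C" "v (sup A C) \<longleftrightarrow> v A \<or> v C"
      using truth_values[OF v(2)] by simp_all
    have "r = (\<Sum>j\<in>J. s j * unit_gain P j (v A, v B, v C))"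
      using v(1) gain_eq[OF refl tv] by simp
    moreover have "\<exists>j\<in>J. given_holds (v A, v B, v C) j"
      using v(3) given_eq[OF refl tv] by simp
    ultimately show "r \<in> {\<Sum>j\<in>J. s j * unit_gain P j \<omega> | \<omega>. \<exists>j\<in>J. given_holds \<omega> j}"
      by blast
  next
    fix r assume "r \<in> {\<Sum>j\<in>J. s j * unit_gain P j \<omega> | \<omega>. \<exists>j\<in>J. given_holds \<omega> j}"
    then obtain \<omega> where \<omega>: "r = (\<Sum>j\<in>J. s j * unit_gain P j \<omega>)" "\<exists>j\<in>J. given_holds \<omega> j"
      by blast
    obtain v where v: "possible ?Xs v" "\<omega> = (v A, v B, v C)" using realised by blast
    have tv: "v (- B) \<longleftrightarrow> \<not> v B" "v (- C) \<longleftrightarrow> \<not> v C" "v (sup A C) \<longleftrightarrow> v A \<or> v C"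
      using truth_values[OF v(1)] by simp_all
    have "r = gain F P J s v" "\<exists>j\<in>J. v (snd (F ! j))"
      using \<omega> gain_eq[OF v(2) tv] given_eq[OF v(2) tv] by simp_all
    with v(1) show "r \<in> gain_values F P J s"
      unfolding gain_values_def by blast
  qed
qed

lemma coherent_iff_gain_signs:
  fixes A B C :: "'a::boolean_algebra"
  assumes indep: "logically_independent3 A B C" and "length P = 4"
  shows "coherent [(B, C), (- B, A), (A, sup A C), (- C, A)] P \<longleftrightarrow>
    (\<forall>J s. J \<noteq> {} \<and> J \<subseteq> {..<4} \<longrightarrow>
      (\<exists>\<omega>. (\<exists>j\<in>J. given_holds \<omega> j) \<and> (\<Sum>j\<in>J. s j * unit_gain P j \<omega>) \<le> 0) \<and>
      (\<exists>\<omega>. (\<exists>j\<in>J. given_holds \<omega> j) \<and> (\<Sum>j\<in>J. s j * unit_gain P j \<omega>) \<ge> 0))"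
proof -
  let ?F = "[(B, C), (- B, A), (A, sup A C), (- C, A)]"
  have len: "length ?F = 4" by simp
  have "inf (inf (literal A True) (literal B True)) (literal C True) \<noteq> bot"
    using indep unfolding logically_independent3_def by blast
  then have nonbot: "A \<noteq> bot" "C \<noteq> bot" by (auto simp: literal_def)
  then have nonbot_F: "\<forall>(E, H) \<in> set ?F. H \<noteq> bot" by (simp add: sup_eq_bot_iff)
  have signs: "Min (gain_values ?F P J s) \<le> 0 \<and> Max (gain_values ?F P J s) \<ge> 0 \<longleftrightarrow>
      (\<exists>\<omega>. (\<exists>j\<in>J. given_holds \<omega> j) \<and> (\<Sum>j\<in>J. s j * unit_gain P j \<omega>) \<le> 0) \<and>
      (\<exists>\<omega>. (\<exists>j\<in>J. given_holds \<omega> j) \<and> (\<Sum>j\<in>J. s j * unit_gain P j \<omega>) \<ge> 0)"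
    if J: "J \<noteq> {}" "J \<subseteq> {..<4}" for J s
  proof -
    let ?V = "gain_values ?F P J s"
    have range: "J \<subseteq> {..<length ?F}" using J(2) by (simp only: len)
    note V = gain_values_finite[OF range, of P s] gain_values_nonempty[OF J(1) range nonbot_F, of P s]
    have "(Min ?V \<le> 0 \<and> Max ?V \<ge> 0) = ((\<exists>r\<in>?V. r \<le> 0) \<and> (\<exists>r\<in>?V. r \<ge> 0))"
      by (simp only: Min_le_iff[OF V] Max_ge_iff[OF V])
    also have "\<dots> = ((\<exists>\<omega>. (\<exists>j\<in>J. given_holds \<omega> j) \<and> (\<Sum>j\<in>J. s j * unit_gain P j \<omega>) \<le> 0) \<and>
        (\<exists>\<omega>. (\<exists>j\<in>J. given_holds \<omega> j) \<and> (\<Sum>j\<in>J. s j * unit_gain P j \<omega>) \<ge> 0))"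
      unfolding gain_values_constituents[OF indep J(2)] by blast
    finally show ?thesis .
  qed
  have "coherent ?F P \<longleftrightarrow> (\<forall>J s. J \<noteq> {} \<and> J \<subseteq> {..<4} \<longrightarrow>
      Min (gain_values ?F P J s) \<le> 0 \<and> Max (gain_values ?F P J s) \<ge> 0)"
    unfolding coherent_def len by (simp only: assms(2) eqTrueI[OF nonbot_F] simp_thms)
  also have "\<dots> \<longleftrightarrow> (\<forall>J s. J \<noteq> {} \<and> J \<subseteq> {..<4} \<longrightarrow>
      (\<exists>\<omega>. (\<exists>j\<in>J. given_holds \<omega> j) \<and> (\<Sum>j\<in>J. s j * unit_gain P j \<omega>) \<le> 0) \<and>
      (\<exists>\<omega>. (\<exists>j\<in>J. given_holds \<omega> j) \<and> (\<Sum>j\<in>J. s j * unit_gain P j \<omega>) \<ge> 0))"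
    by (intro iff_allI imp_cong refl) (elim conjE, rule signs)
  finally show ?thesis .
qed

section \<open>Necessity\<close>

lemma coherent_imp_inequalities:
  fixes A B C :: "'a::boolean_algebra"
  assumes "logically_independent3 A B C"
    and "coherent [(B, C), (- B, A), (A, sup A C), (- C, A)] [x, y, t, z]"
  shows "0 \<le> z" "z \<le> 1" "t * (1 - y - z) \<le> x * (1 - t * z)" "x * (1 - t * z) \<le> 1 - t * y"
proof -
  note signs = assms(2)[unfolded coherent_iff_gain_signs[OF assms(1), of "[x, y, t, z]", simplified],
      rule_format]
  have four: "{..<4} = {0, 1, 2, 3::nat}" by auto
  have low: "\<exists>\<omega>. (\<exists>j\<in>J. given_holds \<omega> j) \<and> (\<Sum>j\<in>J. s j * unit_gain [x, y, t, z] j \<omega>) \<le> 0"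
    and high: "\<exists>\<omega>. (\<exists>j\<in>J. given_holds \<omega> j) \<and> (\<Sum>j\<in>J. s j * unit_gain [x, y, t, z] j \<omega>) \<ge> 0"
    if "J \<noteq> {}" "J \<subseteq> {..<4}" for J s
    using signs[of J s] that by auto
  from low[of "{3}" "\<lambda>_. 1"] show "0 \<le> z"
    by (auto simp: given_holds_def event_holds_def unit_gain_def of_bool_def split: if_splits)
  from high[of "{3}" "\<lambda>_. 1"] show "z \<le> 1"
    by (auto simp: given_holds_def event_holds_def unit_gain_def of_bool_def split: if_splits)
  \<comment> \<open>The gain is \<open>BC + A \<not>B + A \<not>C - A\<close>, which is nonnegative, plus
    \<open>t(1 - y - z) - x(1 - tz)\<close>: on \<open>A \<or> C\<close> the stake \<open>1 - x\<close> completes \<open>xC\<close> to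
    \<open>x(C + A \<not>C) = x\<close>, and the stake on \<open>A|(A \<or> C)\<close> turns the coefficient of \<open>A\<close> into \<open>-1\<close>.\<close>
  define s where "s = (\<lambda>j. [1, 1, - (1 - y - (1 - x) * z), 1 - x] ! j)"
  obtain a b c where "a \<or> c"
    "(\<Sum>j\<in>{..<4}. s j * unit_gain [x, y, t, z] j (a, b, c)) \<le> 0"
    using low[of "{..<4}" s] by (auto simp: four given_holds_def)
  then show "t * (1 - y - z) \<le> x * (1 - t * z)"
    by (cases a; cases b; cases c)
      (simp_all add: four s_def given_holds_def event_holds_def unit_gain_def algebra_simps)
  \<comment> \<open>In the same way, the gain is \<open>BC + A \<not>B - 1\<close>, which is at most \<open>0\<close>, plus
    \<open>1 - ty - x(1 - tz)\<close>.\<close>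
  define s where "s = (\<lambda>j. [1, 1, y - x * z, - x] ! j)"
  obtain a b c where "a \<or> c"
    "(\<Sum>j\<in>{..<4}. s j * unit_gain [x, y, t, z] j (a, b, c)) \<ge> 0"
    using high[of "{..<4}" s] by (auto simp: four given_holds_def)
  then show "x * (1 - t * z) \<le> 1 - t * y"
    by (cases a; cases b; cases c)
      (simp_all add: four s_def given_holds_def event_holds_def unit_gain_def algebra_simps)
qed

section \<open>Sufficiency\<close>

text \<open>The easy half of the duality between betting and averaging.\<close>

lemma signs_of_zero_mean:
  fixes w g :: "'p::finite \<Rightarrow> real"
  assumes nonneg: "\<And>\<omega>. 0 \<le> w \<omega>" and total: "sum w UNIV = 1"
    and support: "\<And>\<omega>. w \<omega> \<noteq> 0 \<Longrightarrow> Q \<omega>"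
    and mean: "(\<Sum>\<omega>\<in>UNIV. w \<omega> * g \<omega>) = 0"
  shows "(\<exists>\<omega>. Q \<omega> \<and> g \<omega> \<le> 0) \<and> (\<exists>\<omega>. Q \<omega> \<and> g \<omega> \<ge> 0)"
proof -
  have "\<exists>\<omega>. Q \<omega> \<and> h \<omega> \<le> 0" if zero: "(\<Sum>\<omega>\<in>UNIV. w \<omega> * h \<omega>) = 0" for h
  proof (rule ccontr)
    assume "\<not> ?thesis"
    then have pos: "w \<omega> \<noteq> 0 \<Longrightarrow> 0 < h \<omega>" for \<omega> using support by force
    then have "\<forall>\<omega>\<in>UNIV. 0 \<le> w \<omega> * h \<omega>"
      using nonneg by (metis less_imp_le mult_nonneg_nonneg mult_zero_left order_refl)
    with zero have "w \<omega> * h \<omega> = 0" for \<omega>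
      by (simp add: sum_nonneg_eq_0_iff)
    with pos have "w \<omega> = 0" for \<omega> by (metis less_irrefl mult_eq_0_iff)
    with total show False by simp
  qed
  from this[of g] this[of "\<lambda>\<omega>. - g \<omega>"] mean show ?thesis
    by (simp add: sum_negf)
qed

lemma gain_signs_of_fair_weights:
  fixes w :: "bool \<times> bool \<times> bool \<Rightarrow> real"
  assumes "\<And>\<omega>. 0 \<le> w \<omega>" "sum w UNIV = 1" "\<And>\<omega>. w \<omega> \<noteq> 0 \<Longrightarrow> \<exists>j\<in>J. given_holds \<omega> j"
    and fair: "\<And>j. j \<in> J \<Longrightarrow> (\<Sum>\<omega>\<in>UNIV. w \<omega> * unit_gain P j \<omega>) = 0"
  shows "(\<exists>\<omega>. (\<exists>j\<in>J. given_holds \<omega> j) \<and> (\<Sum>j\<in>J. s j * unit_gain P j \<omega>) \<le> 0) \<and>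
    (\<exists>\<omega>. (\<exists>j\<in>J. given_holds \<omega> j) \<and> (\<Sum>j\<in>J. s j * unit_gain P j \<omega>) \<ge> 0)"
proof (rule signs_of_zero_mean[where w = w])
  have "(\<Sum>\<omega>\<in>UNIV. w \<omega> * (\<Sum>j\<in>J. s j * unit_gain P j \<omega>)) =
      (\<Sum>j\<in>J. s j * (\<Sum>\<omega>\<in>UNIV. w \<omega> * unit_gain P j \<omega>))"
    unfolding sum_distrib_left by (subst sum.swap) (simp add: mult.left_commute)
  then show "(\<Sum>\<omega>\<in>UNIV. w \<omega> * (\<Sum>j\<in>J. s j * unit_gain P j \<omega>)) = 0"
    by (simp add: fair)
qed (use assms in auto)

lemma sum_bool_triples:
  fixes f :: "bool \<times> bool \<times> bool \<Rightarrow> real"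
  shows "sum f UNIV = f (True, True, True) + f (True, True, False) + f (True, False, True) +
    f (True, False, False) + f (False, True, True) + f (False, True, False) +
    f (False, False, True) + f (False, False, False)"
  unfolding UNIV_Times_UNIV[symmetric] sum.cartesian_product' by (simp add: UNIV_bool)

text \<open>
  Here \<open>q\<close> and \<open>u\<close> are the masses of \<open>ABC\<close> and \<open>\<not>A BC\<close>. The first four conclusions say
  that the four parts of \<open>A\<close> determined by \<open>q\<close> and the margins have nonnegative mass. Taking
  \<open>q\<close> as large as \<open>P(BC)\<close> and the upper Frechet bound permit leaves the smallest \<open>u\<close>.
\<close>

lemma joint_masses:
  fixes x y t z :: real
  assumes "x \<in> {0..1}" "y \<in> {0..1}" "t \<in> {0..1}" "z \<in> {0..1}"
    and "t * (1 - y - z) \<le> x * (1 - t * z)" "x * (1 - t * z) \<le> 1 - t * y"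
  obtains q u where "0 \<le> q" "q \<le> t * (1 - y)" "q \<le> t * (1 - z)" "t * (1 - y - z) \<le> q"
    "0 \<le> u" "u \<le> 1 - t" "q + u = x * (1 - t * z)"
proof -
  define r where "r = x * (1 - t * z)"
  define q where "q = min r (min (t * (1 - y)) (t * (1 - z)))"
  have tz: "t * z \<le> 1" using assms(3,4) mult_le_one by auto
  have nonneg: "0 \<le> r" "0 \<le> t * (1 - y)" "0 \<le> t * (1 - z)" "0 \<le> t * y" "0 \<le> t * z"
    using assms(1-4) tz by (auto simp: r_def)
  \<comment> \<open>\<open>P(BC) \<le> P(C)\<close>: this upper bound holds for every \<open>z\<close>.\<close>
  have "r \<le> 1 - t * z"
    unfolding r_def using assms(1) tz mult_right_mono[of x 1 "1 - t * z"] by auto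
  then have r: "r \<le> 1 - t + t * (1 - z)" "r \<le> 1 - t + t * (1 - y)"
    using assms(6) by (simp_all add: r_def algebra_simps)
  have "t * (1 - y - z) \<le> t * (1 - y)" "t * (1 - y - z) \<le> t * (1 - z)"
    using nonneg by (simp_all add: algebra_simps)
  with nonneg assms(5) have "0 \<le> q" "t * (1 - y - z) \<le> q"
    by (simp_all add: q_def flip: r_def)
  moreover have "q \<le> t * (1 - y)" "q \<le> t * (1 - z)" "q \<le> r"
    by (simp_all add: q_def)
  moreover have "r - q \<le> 1 - t"
    using r assms(3) by (auto simp: q_def min_def)
  ultimately show thesis
    by (intro that[of q "r - q"]) (simp_all add: r_def)
qed

lemma coherent_of_inequalities:
  fixes A B C :: "'a::boolean_algebra" and x y t z :: real
  assumes indep: "logically_independent3 A B C"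
    and unit: "x \<in> {0..1}" "y \<in> {0..1}" "t \<in> {0..1}" "z \<in> {0..1}"
    and bounds: "t * (1 - y - z) \<le> x * (1 - t * z)" "x * (1 - t * z) \<le> 1 - t * y"
  shows "coherent [(B, C), (- B, A), (A, sup A C), (- C, A)] [x, y, t, z]"
proof -
  let ?P = "[x, y, t, z]"
  have fair_weights: "\<exists>w. (\<forall>\<omega>. 0 \<le> w \<omega>) \<and> sum w UNIV = 1 \<and> (\<forall>\<omega>. w \<omega> \<noteq> 0 \<longrightarrow> (\<exists>j\<in>J. given_holds \<omega> j)) \<and>
      (\<forall>j\<in>J. (\<Sum>\<omega>\<in>UNIV. w \<omega> * unit_gain ?P j \<omega>) = 0)"
    if J: "J \<noteq> {}" "J \<subseteq> {..<4}" for J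
  proof -
    have four: "j = 0 \<or> j = 1 \<or> j = 2 \<or> j = 3" if "j \<in> J" for j
      using that J(2) by auto
    consider (whole) "2 \<in> J" | (on_C) "2 \<notin> J" "0 \<in> J" | (on_A) "J \<subseteq> {1, 3}"
      using four by blast
    then show ?thesis
    proof cases
      case whole
      obtain q u where qu: "0 \<le> q" "q \<le> t * (1 - y)" "q \<le> t * (1 - z)" "t * (1 - y - z) \<le> q"
        "0 \<le> u" "u \<le> 1 - t" "q + u = x * (1 - t * z)"
        using joint_masses[OF unit bounds] by blast
      define w :: "bool \<times> bool \<times> bool \<Rightarrow> real" where "w = (\<lambda>(a, b, c).
        if a then (if b then (if c then q else t * (1 - y) - q)
                   else (if c then t * (1 - z) - q else q - t * (1 - y - z)))
        else if c then (if b then u else 1 - t - u) else 0)"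
      have "\<forall>\<omega>. 0 \<le> w \<omega>" using qu by (auto simp: w_def)
      moreover have "sum w UNIV = 1"
        unfolding sum_bool_triples w_def by (simp add: algebra_simps)
      moreover have "\<forall>\<omega>. w \<omega> \<noteq> 0 \<longrightarrow> (\<exists>j\<in>J. given_holds \<omega> j)"
        using whole by (auto simp: w_def given_holds_def split: if_splits intro!: bexI[of _ 2])
      moreover have "(\<Sum>\<omega>\<in>UNIV. w \<omega> * unit_gain ?P j \<omega>) = 0" if "j \<in> J" for j
      proof -
        have u: "u = x * (1 - t * z) - q" using qu(7) by simp
        show ?thesis using four[OF that]
          by (elim disjE) (simp_all add: sum_bool_triples w_def unit_gain_def given_holds_def
              event_holds_def u algebra_simps)
      qed
      ultimately show ?thesis by blast
    next
      case on_C
      define w :: "bool \<times> bool \<times> bool \<Rightarrow> real" where "w = (\<lambda>(a, b, c).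
        if \<not> a \<and> c then (if b then x else 1 - x) else 0)"
      have "\<forall>\<omega>. 0 \<le> w \<omega>" using unit by (auto simp: w_def)
      moreover have "sum w UNIV = 1"
        unfolding sum_bool_triples w_def by simp
      moreover have "\<forall>\<omega>. w \<omega> \<noteq> 0 \<longrightarrow> (\<exists>j\<in>J. given_holds \<omega> j)"
        using on_C by (auto simp: w_def given_holds_def split: if_splits intro!: bexI[of _ 0])
      moreover have "(\<Sum>\<omega>\<in>UNIV. w \<omega> * unit_gain ?P j \<omega>) = 0" if "j \<in> J" for j
      proof -
        have "j = 0 \<or> j = 1 \<or> j = 3" using four[OF that] that on_C by blast
        then show ?thesis
          by (elim disjE) (simp_all add: sum_bool_triples w_def unit_gain_def given_holds_def
              event_holds_def algebra_simps)
      qed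
      ultimately show ?thesis by blast
    next
      case on_A
      \<comment> \<open>Given \<open>A\<close>, the events \<open>\<not>B\<close> and \<open>\<not>C\<close> are made stochastically independent.\<close>
      define w :: "bool \<times> bool \<times> bool \<Rightarrow> real" where "w = (\<lambda>(a, b, c).
        if a then (if b then 1 - y else y) * (if c then 1 - z else z) else 0)"
      have "\<forall>\<omega>. 0 \<le> w \<omega>" using unit by (auto simp: w_def)
      moreover have "sum w UNIV = 1"
        unfolding sum_bool_triples w_def by (simp add: algebra_simps)
      moreover have "\<forall>\<omega>. w \<omega> \<noteq> 0 \<longrightarrow> (\<exists>j\<in>J. given_holds \<omega> j)"
      proof -
        obtain j where j: "j \<in> J" using J(1) by blast
        then have "j = 1 \<or> j = 3" using on_A by blast
        then show ?thesis
          using j by (auto simp: w_def given_holds_def split: if_splits intro!: bexI[of _ j])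
      qed
      moreover have "(\<Sum>\<omega>\<in>UNIV. w \<omega> * unit_gain ?P j \<omega>) = 0" if "j \<in> J" for j
      proof -
        have "j = 1 \<or> j = 3" using that on_A by blast
        then show ?thesis
          by (elim disjE) (simp_all add: sum_bool_triples w_def unit_gain_def given_holds_def
              event_holds_def algebra_simps)
      qed
      ultimately show ?thesis by blast
    qed
  qed
  have "(\<exists>\<omega>. (\<exists>j\<in>J. given_holds \<omega> j) \<and> (\<Sum>j\<in>J. s j * unit_gain ?P j \<omega>) \<le> 0) \<and>
      (\<exists>\<omega>. (\<exists>j\<in>J. given_holds \<omega> j) \<and> (\<Sum>j\<in>J. s j * unit_gain ?P j \<omega>) \<ge> 0)"
    if J: "J \<noteq> {}" "J \<subseteq> {..<4}" for J s
  proof -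
    obtain w where w: "\<forall>\<omega>. 0 \<le> w \<omega>" "sum w UNIV = 1"
      "\<forall>\<omega>. w \<omega> \<noteq> 0 \<longrightarrow> (\<exists>j\<in>J. given_holds \<omega> j)"
      "\<forall>j\<in>J. (\<Sum>\<omega>\<in>UNIV. w \<omega> * unit_gain ?P j \<omega>) = 0"
      using fair_weights[OF J] by blast
    show ?thesis
      by (rule gain_signs_of_fair_weights[of w J ?P s]) (use w in blast)+
  qed
  then show ?thesis
    by (subst coherent_iff_gain_signs[OF indep]) simp_all
qed

section \<open>The interval of coherent extensions\<close>

theorem theorem7:
  fixes A B C :: "'a::boolean_algebra" and x y t z :: real
  assumes "logically_independent3 A B C"
    and "x \<in> {0..1}" and "y \<in> {0..1}" and "t \<in> {0..1}"
  shows "coherent [(B, C), (- B, A), (A, sup A C), (- C, A)] [x, y, t, z] \<longleftrightarrow>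
    z \<in> (if t \<le> x + y * t \<and> x + y * t \<le> 1 then {0..1}
         else if x + y * t > 1 then {(x + y * t - 1) / (t * x)..1}
         else {(t - x - y * t) / (t * (1 - x))..1})"
proof -
  have "coherent [(B, C), (- B, A), (A, sup A C), (- C, A)] [x, y, t, z] \<longleftrightarrow>
      0 \<le> z \<and> z \<le> 1 \<and> t - x - y * t \<le> z * (t * (1 - x)) \<and> x + y * t - 1 \<le> z * (t * x)"
    (is "?coh \<longleftrightarrow> ?ineqs")
  proof
    assume ?coh
    from coherent_imp_inequalities[OF assms(1) this] show ?ineqs by (simp add: algebra_simps)
  next
    assume ?ineqs
    then show ?coh
      by (intro coherent_of_inequalities[OF assms]) (auto simp: algebra_simps)
  qed
  also have "\<dots> \<longleftrightarrow> z \<in> (if t \<le> x + y * t \<and> x + y * t \<le> 1 then {0..1}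
         else if x + y * t > 1 then {(x + y * t - 1) / (t * x)..1}
         else {(t - x - y * t) / (t * (1 - x))..1})"
  proof -
    have yt: "0 \<le> y * t" "y * t \<le> t" using assms(2-4) mult_right_mono[of y 1 t] by auto
    have products: "0 \<le> z * (t * (1 - x))" "0 \<le> z * (t * x)" if "0 \<le> z"
      using that assms(2-4) by auto
    have nonneg: "0 \<le> z" if "0 < d" "d \<le> z * k" "0 < k" for d k :: real
      using that by (meson less_imp_le less_le_trans zero_less_mult_pos2)
    consider (middle) "t \<le> x + y * t" "x + y * t \<le> 1" | (high) "x + y * t > 1"
      | (low) "x + y * t < t" by linarith
    then show ?thesis
    proof cases
      case middle
      then show ?thesis using products by auto
    next
      case high
      have "0 < t" "0 < x" using high yt assms(2-4) by (auto simp: less_le)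
      then have pos: "0 < t * x" by simp
      have "0 \<le> z" if "x + y * t - 1 \<le> z * (t * x)"
        using nonneg[OF _ that pos] high by simp
      with high pos products(1) assms(4) show ?thesis
        by (fastforce simp: pos_divide_le_eq)
    next
      case low
      have "0 < t" "x < 1" using low yt assms(2-4) by auto
      then have pos: "0 < t * (1 - x)" by simp
      have "0 \<le> z" if "t - x - y * t \<le> z * (t * (1 - x))"
        using nonneg[OF _ that pos] low by simp
      with low pos products(2) assms(4) show ?thesis
        by (fastforce simp: pos_divide_le_eq)
    qed
  qed
  finally show ?thesis .
qed

end
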